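(* If $G$ is an algorithmically stackable group, then $G$ has solvable word problem.
   Context: Conventions. $A$ is a finite symmetric generating set of a group $G$ (closed under inversion: each $a\in A$ has a formal inverse $a^{-1}\in A$), and no element of $A$ represents the identity $\epsilon$ of $G$. $A^*$ is the set of words over $A$; $1$ is the empty word; $v=w$ means equality as words and $v=_G w$ means equality in $G$. $\Gamma$ is the Cayley graph of $G$ with respect to $A$, with set of directed edges $\vec E(\Gamma)$. For $g\in G$, $a\in A$, $e_{g,a}$ is the directed edge labeled $a$ from $g$ to $ga$; for $x\in A^*$ representing $g$, $e_{x,a}:=e_{g,a}$. A set of normal forms $\mathcal N=\{y_g\mid g\in G\}\subseteq A^*$ contains exactly one word $y_g$ representing each $g\in G$. The degenerate edges are $\vec E_d:=\{e_{g,a}\mid y_ga=y_{ga}\text{ or }y_g=y_{ga}a^{-1}\text{ as words}\}$; the recursive edges are $\vec E_r:=\vec E(\Gamma)\setminus\vec E_d$. For a function $c:\vec E_r\to A^*$, let $<_c$ be the transitive closure of the relation: $e'<_c e$ whenever $e,e'\in\vec E_r$ and $e'$ lies (with the direction of the path) on the path in $\Gamma$ starting at the initial vertex of $e$ and labeled $c(e)$. A stacking for $G$ with respect to $A$ is a pair $(\mathcal N,c)$ where $\mathcal N$ is a set of normal forms with $y_\epsilon=1$ and $c:\vec E_r\to A^*$ satisfies: (S1) $c(e_{g,a})=_G a$ for each $e_{g,a}\in\vec E_r$; (S2) $<_c$ is a strict partial ordering on $\vec E_r$ such that for each $e\in\vec E_r$ there are only finitely many $e''\in\vec E_r$ with $e''<_c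 e$; (S3) the image $c(\vec E_r)\subset A^*$ is finite. Let $c'(e):=c(e)$ for $e\in\vec E_r$ and $c'(e):=a$ for $e\in\vec E_d$ with label $a$, and let $S_c:=\{(w,a,c'(e_{w,a}))\mid w\in A^*,a\in A\}\subseteq A^*\times A\times A^*$. $G$ is algorithmically stackable if it has a finite symmetric generating set $A$ with a stacking $(\mathcal N,c)$ such that $S_c$ is recursive (computable). *)

theory Defs
  imports "HOL-Algebra.Generated_Groups" "HOL-Library.Nat_Bijection"
begin

section \<open>Recursive functions and recursive sets\<close>

text \<open>
  \<open>recursive_fun n f\<close>: \<open>f\<close>, restricted to argument lists of length \<open>n\<close>, is a total recursive
  function. This is Kleene's class, with minimization applied to regular functions only, so that
  no partial functions arise. Values on lists of other lengths are irrelevant.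
\<close>

inductive recursive_fun :: "nat \<Rightarrow> (nat list \<Rightarrow> nat) \<Rightarrow> bool" where
  zero: "recursive_fun n (\<lambda>xs. 0)"
| succ: "recursive_fun 1 (\<lambda>xs. Suc (xs ! 0))"
| proj: "i < n \<Longrightarrow> recursive_fun n (\<lambda>xs. xs ! i)"
| compose: "recursive_fun (length gs) f \<Longrightarrow> (\<forall>g\<in>set gs. recursive_fun n g)
    \<Longrightarrow> recursive_fun n (\<lambda>xs. f (map (\<lambda>g. g xs) gs))"
| prim_rec: "recursive_fun n f \<Longrightarrow> recursive_fun (Suc (Suc n)) h
    \<Longrightarrow> recursive_fun (Suc n)
          (\<lambda>xs. rec_nat (f (tl xs)) (\<lambda>k r. h (k # r # tl xs)) (hd xs))"
| minimize: "recursive_fun (Suc n) f \<Longrightarrow> (\<forall>xs. length xs = n \<longrightarrow> (\<exists>k. f (k # xs) = 0))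
    \<Longrightarrow> recursive_fun n (\<lambda>xs. LEAST k. f (k # xs) = 0)"

definition recursive_set :: "nat set \<Rightarrow> bool" where
  "recursive_set X \<longleftrightarrow>
     (\<exists>f. recursive_fun 1 f \<and> (\<forall>x. f [x] = (if x \<in> X then 1 else 0)))"

definition triple_encode :: "nat list \<times> nat \<times> nat list \<Rightarrow> nat" where
  "triple_encode = (\<lambda>(w, a, u). prod_encode (list_encode w, prod_encode (a, list_encode u)))"


section \<open>Symmetric generating sets\<close>

text \<open>
  The elements of \<open>A\<close> are letters; the letter \<open>a\<close> represents the group element \<open>rep a\<close>, and
  \<open>formal_inv a\<close> is the letter \<open>a\<inverse>\<close>. The case of a subset of the group is \<open>rep = id\<close>,
  \<open>formal_inv = m_inv G\<close>. The words over \<open>A\<close> are the elements of \<open>lists A\<close>.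
\<close>

locale symmetric_generating_set = group G for G (structure) +
  fixes A :: "'l set" and rep :: "'l \<Rightarrow> 'a" and formal_inv :: "'l \<Rightarrow> 'l"
  assumes finite_letters: "finite A"
    and rep_closed: "a \<in> A \<Longrightarrow> rep a \<in> carrier G"
    and generates: "generate G (rep ` A) = carrier G"
    and formal_inv_closed: "a \<in> A \<Longrightarrow> formal_inv a \<in> A"
    and formal_inv_formal_inv: "a \<in> A \<Longrightarrow> formal_inv (formal_inv a) = a"
    and rep_formal_inv: "a \<in> A \<Longrightarrow> rep (formal_inv a) = inv (rep a)"
    and rep_not_one: "a \<in> A \<Longrightarrow> rep a \<noteq> \<one>"
begin

fun word_val :: "'l list \<Rightarrow> 'a" where
  "word_val [] = \<one>"
| "word_val (a # w) = rep a \<otimes> word_val w"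

definition word_problem :: "'l list set" where
  "word_problem = {w \<in> lists A. word_val w = \<one>}"


section \<open>Stackings\<close>

text \<open>The pair \<open>(g, a)\<close> is the directed edge labelled \<open>a\<close> from \<open>g\<close> to \<open>g \<otimes> rep a\<close>.\<close>

definition edges :: "('a \<times> 'l) set" where
  "edges = carrier G \<times> A"

fun path_edges :: "'a \<Rightarrow> 'l list \<Rightarrow> ('a \<times> 'l) set" where
  "path_edges g [] = {}"
| "path_edges g (a # w) = insert (g, a) (path_edges (g \<otimes> rep a) w)"

definition normal_forms :: "'l list set \<Rightarrow> bool" where
  "normal_forms N \<longleftrightarrow>
     N \<subseteq> lists A \<and> (\<forall>g\<in>carrier G. \<exists>!w. w \<in> N \<and> word_val w = g)"

definition nf :: "'l list set \<Rightarrow> 'a \<Rightarrow> 'l list" where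
  "nf N g = (THE w. w \<in> N \<and> word_val w = g)"

definition degenerate_edges :: "'l list set \<Rightarrow> ('a \<times> 'l) set" where
  "degenerate_edges N = {(g, a) \<in> edges.
     nf N g @ [a] = nf N (g \<otimes> rep a) \<or> nf N g = nf N (g \<otimes> rep a) @ [formal_inv a]}"

definition recursive_edges :: "'l list set \<Rightarrow> ('a \<times> 'l) set" where
  "recursive_edges N = edges - degenerate_edges N"

definition edge_order ::
  "'l list set \<Rightarrow> ('a \<times> 'l \<Rightarrow> 'l list) \<Rightarrow> (('a \<times> 'l) \<times> ('a \<times> 'l)) set" where
  "edge_order N c = {(e', e). e' \<in> recursive_edges N \<and> e \<in> recursive_edges N \<and>
                              e' \<in> path_edges (fst e) (c e)}\<^sup>+"

text \<open>Only the values of \<open>c\<close> on the recursive edges matter.\<close>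

definition stacking :: "'l list set \<Rightarrow> ('a \<times> 'l \<Rightarrow> 'l list) \<Rightarrow> bool" where
  "stacking N c \<longleftrightarrow>
     normal_forms N \<and> nf N \<one> = [] \<and>
     c ` recursive_edges N \<subseteq> lists A \<and>
     (\<forall>(g, a)\<in>recursive_edges N. word_val (c (g, a)) = rep a) \<and>
     irrefl (edge_order N c) \<and> trans (edge_order N c) \<and>
     (\<forall>e\<in>recursive_edges N. finite {e' \<in> recursive_edges N. (e', e) \<in> edge_order N c}) \<and>
     finite (c ` recursive_edges N)"

definition extended_map ::
  "'l list set \<Rightarrow> ('a \<times> 'l \<Rightarrow> 'l list) \<Rightarrow> 'a \<times> 'l \<Rightarrow> 'l list" where
  "extended_map N c e = (if e \<in> recursive_edges N then c e else [snd e])"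

definition stacking_set ::
  "'l list set \<Rightarrow> ('a \<times> 'l \<Rightarrow> 'l list) \<Rightarrow> ('l list \<times> 'l \<times> 'l list) set" where
  "stacking_set N c =
     {(w, a, extended_map N c (word_val w, a)) | w a. w \<in> lists A \<and> a \<in> A}"

end


section \<open>Algorithmic stackability and the word problem\<close>

text \<open>
  Alphabets are finite, so their letters may be taken to be natural numbers; words are then coded
  by \<open>list_encode\<close>. Solvability of the word problem does not depend on the finite generating set,
  and is stated here for all of them.
\<close>

definition algorithmically_stackable :: "('a, 'b) monoid_scheme \<Rightarrow> bool" where
  "algorithmically_stackable G \<longleftrightarrow>
     (\<exists>(A :: nat set) rep formal_inv N c.
        symmetric_generating_set G A rep formal_inv \<and>
        symmetric_generating_set.stacking G A rep formal_inv N c \<and>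
        recursive_set
          (triple_encode ` symmetric_generating_set.stacking_set G A rep formal_inv N c))"

definition solvable_word_problem :: "('a, 'b) monoid_scheme \<Rightarrow> bool" where
  "solvable_word_problem G \<longleftrightarrow>
     (\<exists>(A :: nat set) rep formal_inv. symmetric_generating_set G A rep formal_inv) \<and>
     (\<forall>(A :: nat set) rep formal_inv. symmetric_generating_set G A rep formal_inv \<longrightarrow>
        recursive_set (list_encode ` symmetric_generating_set.word_problem G A rep))"

end

(*
  A pushdown-like machine reads a word while keeping on its stack the normal form of the group
  element reached so far. At a degenerate edge it pushes or cancels a letter; at a recursive edge e
  it replaces the letter to be read by the word c(e). Well-foundedness of <_c makes this stop, and
  the stack is then empty exactly if the input represents the identity. Since S_c is recursive, so is
  one step of the machine, and its halting time is found by minimization. A word over another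
  generating set is first translated letter by letter.
*)
theory Submission
  imports Defs
begin

section \<open>Closure properties of recursive functions\<close>

text \<open>\<open>recursive_fun\<close> fixes a function on lists of all lengths. Closing it under
  agreement on lists of length \<open>n\<close> lets the values elsewhere be ignored, so that the
  closure rules can be applied to functions written down freely.\<close>

definition nary :: "nat \<Rightarrow> (nat list \<Rightarrow> nat) \<Rightarrow> bool" where
  "nary n f \<longleftrightarrow> (\<exists>F. recursive_fun n F \<and> (\<forall>xs. length xs = n \<longrightarrow> F xs = f xs))"

lemma nary_cong:
  assumes "nary n f" and "\<And>xs. length xs = n \<Longrightarrow> f xs = g xs"
  shows "nary n g"
  using assms unfolding nary_def by auto

lemma nary_nth: "i < n \<Longrightarrow> nary n (\<lambda>xs. xs ! i)"
  unfolding nary_def using recursive_fun.proj by blast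

lemma nary_compose:
  assumes "nary (length gs) f" and "\<And>g. g \<in> set gs \<Longrightarrow> nary n g"
  shows "nary n (\<lambda>xs. f (map (\<lambda>g. g xs) gs))"
proof -
  obtain F where F: "recursive_fun (length gs) F"
    "\<And>xs. length xs = length gs \<Longrightarrow> F xs = f xs"
    using assms(1) unfolding nary_def by blast
  obtain R where R: "\<And>g. g \<in> set gs \<Longrightarrow> recursive_fun n (R g)"
    "\<And>g xs. g \<in> set gs \<Longrightarrow> length xs = n \<Longrightarrow> R g xs = g xs"
    using assms(2) unfolding nary_def by metis
  have "recursive_fun n (\<lambda>xs. F (map (\<lambda>g. g xs) (map R gs)))"
    by (rule recursive_fun.compose) (use F(1) R(1) in auto)
  moreover have "F (map (\<lambda>g. g xs) (map R gs)) = f (map (\<lambda>g. g xs) gs)" if "length xs = n" for xs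
  proof -
    have "map (\<lambda>g. g xs) (map R gs) = map (\<lambda>g. g xs) gs"
      using R(2) that by simp
    moreover have "F (map (\<lambda>g. g xs) gs) = f (map (\<lambda>g. g xs) gs)"
      by (rule F(2)) simp
    ultimately show ?thesis by (simp only:)
  qed
  ultimately show ?thesis unfolding nary_def by blast
qed

lemma nary_compose1: "nary 1 (\<lambda>xs. f (xs ! 0)) \<Longrightarrow> nary n g \<Longrightarrow> nary n (\<lambda>xs. f (g xs))"
  using nary_compose[of "[g]" "\<lambda>xs. f (xs ! 0)" n] by simp

lemma nary_tl: "nary n f \<Longrightarrow> nary (Suc n) (\<lambda>xs. f (tl xs))"
proof -
  assume f: "nary n f"
  have "nary (Suc n) (\<lambda>xs. f (map (\<lambda>g. g xs) (map (\<lambda>i xs. xs ! Suc i) [0..<n])))"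
    by (rule nary_compose) (use f nary_nth in auto)
  moreover have "map (\<lambda>g. g xs) (map (\<lambda>i xs. xs ! Suc i) [0..<n]) = tl xs"
    if "length xs = Suc n" for xs :: "nat list"
    by (rule nth_equalityI) (use that in \<open>auto simp: nth_tl\<close>)
  ultimately show ?thesis
    by (elim nary_cong) (simp only:)
qed

lemma nary_tl_tl: "nary n f \<Longrightarrow> nary (Suc (Suc n)) (\<lambda>xs. f (tl (tl xs)))"
  using nary_tl[OF nary_tl] .

text \<open>\<open>prim_rec\<close> recurses on the head of the argument list with the tail as
  parameters. Composing with the list of \<open>k\<close> followed by all projections makes the
  recursion bound an arbitrary function of those same parameters.\<close>

lemma nary_rec:
  assumes a: "nary n a" and k: "nary n k"
    and h: "nary (Suc (Suc n)) (\<lambda>xs. h (xs ! 0) (xs ! 1) (tl (tl xs)))"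
  shows "nary n (\<lambda>xs. rec_nat (a xs) (\<lambda>i r. h i r xs) (k xs))"
proof -
  obtain R where R: "recursive_fun n R" "\<And>xs. length xs = n \<Longrightarrow> R xs = a xs"
    using a unfolding nary_def by blast
  obtain H where H: "recursive_fun (Suc (Suc n)) H"
    "\<And>xs. length xs = Suc (Suc n) \<Longrightarrow> H xs = h (xs ! 0) (xs ! 1) (tl (tl xs))"
    using h unfolding nary_def by blast
  let ?P = "\<lambda>xs. rec_nat (R (tl xs)) (\<lambda>k r. H (k # r # tl xs)) (hd xs)"
  let ?gs = "k # map (\<lambda>i xs. xs ! i) [0..<n]"
  have "nary (Suc n) ?P"
    unfolding nary_def using recursive_fun.prim_rec[OF R(1) H(1)] by blast
  then have "nary n (\<lambda>xs. ?P (map (\<lambda>g. g xs) ?gs))"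
    by (intro nary_compose) (use k nary_nth in auto)
  then show ?thesis
  proof (rule nary_cong)
    fix xs :: "nat list"
    assume l: "length xs = n"
    have "map (\<lambda>g. g xs) (map (\<lambda>i xs. xs ! i) [0..<n]) = xs"
      by (rule nth_equalityI) (use l in auto)
    then have "map (\<lambda>g. g xs) ?gs = k xs # xs"
      by (simp only: list.map)
    then show "?P (map (\<lambda>g. g xs) ?gs) = rec_nat (a xs) (\<lambda>i r. h i r xs) (k xs)"
      using l R(2) H(2) by simp
  qed
qed

lemma nary_Least:
  assumes p: "nary (Suc n) (\<lambda>xs. p (xs ! 0) (tl xs))"
    and ex: "\<And>xs. length xs = n \<Longrightarrow> \<exists>k. p k xs = 0"
  shows "nary n (\<lambda>xs. LEAST k. p k xs = 0)"
proof -
  obtain P where P: "recursive_fun (Suc n) P"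
    "\<And>xs. length xs = Suc n \<Longrightarrow> P xs = p (xs ! 0) (tl xs)"
    using p unfolding nary_def by blast
  have "recursive_fun n (\<lambda>xs. LEAST k. P (k # xs) = 0)"
    by (rule recursive_fun.minimize) (use P ex in auto)
  then show ?thesis
    unfolding nary_def using P(2) by force
qed

section \<open>Elementary arithmetic and case distinction\<close>

lemma nary_Suc: "nary n f \<Longrightarrow> nary n (\<lambda>xs. Suc (f xs))"
  by (rule nary_compose1) (use recursive_fun.succ in \<open>auto simp: nary_def\<close>)

lemma nary_const: "nary n (\<lambda>xs. c)"
proof (induction c)
  case 0
  show ?case unfolding nary_def using recursive_fun.zero by blast
qed (rule nary_Suc)

lemma nary_add:
  assumes "nary n f" and "nary n g"
  shows "nary n (\<lambda>xs. f xs + g xs)"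
proof -
  have "rec_nat a (\<lambda>i r. Suc r) b = b + a" for a b :: nat
    by (induction b) auto
  then show ?thesis
    using nary_rec[OF assms(2,1), of "\<lambda>i r xs. Suc r"] by (simp add: nary_Suc nary_nth)
qed

lemma nary_diff:
  assumes "nary n f" and "nary n g"
  shows "nary n (\<lambda>xs. f xs - g xs)"
proof -
  have "nary 1 (\<lambda>xs. rec_nat 0 (\<lambda>i r. i) (xs ! 0))"
    by (intro nary_rec nary_const nary_nth) auto
  moreover have "rec_nat 0 (\<lambda>i r. i) k = k - 1" for k :: nat
    by (cases k) auto
  ultimately have pred: "nary m h \<Longrightarrow> nary m (\<lambda>xs. h xs - 1)" for m h
    using nary_compose1[of "\<lambda>k. k - 1"] by simp
  have "rec_nat a (\<lambda>i r. r - 1) b = a - b" for a b :: nat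
    by (induction b) auto
  then show ?thesis
    using nary_rec[OF assms, of "\<lambda>i r xs. r - 1"] pred[OF nary_nth] by simp
qed

lemma nary_if:
  assumes "nary n p" and "nary n f" and "nary n g"
  shows "nary n (\<lambda>xs. if p xs = 0 then f xs else g xs)"
proof -
  have "rec_nat a (\<lambda>i r. b) k = (if k = 0 then a else b)" for a b k :: nat
    by (cases k) auto
  then show ?thesis
    using nary_rec[OF assms(2,1), of "\<lambda>i r. g"] nary_tl_tl[OF assms(3)] by simp
qed

section \<open>The Cantor pairing function and its inverse\<close>

lemma nary_triangle:
  assumes "nary n f"
  shows "nary n (\<lambda>xs. triangle (f xs))"
proof -
  have "rec_nat 0 (\<lambda>i r. r + Suc i) k = triangle k" for k :: nat
    by (induction k) auto
  then show ?thesis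
    using nary_rec[OF nary_const[of n 0] assms, of "\<lambda>i r xs. r + Suc i"]
    by (simp add: nary_add nary_Suc nary_nth)
qed

lemma nary_prod_encode:
  "nary n f \<Longrightarrow> nary n g \<Longrightarrow> nary n (\<lambda>xs. prod_encode (f xs, g xs))"
  by (simp add: prod_encode_def nary_add nary_triangle)

text \<open>\<open>k z\<close> is the index of the diagonal containing \<open>z\<close>, that is,
  the least \<open>k\<close> with \<open>z < triangle (Suc k)\<close>. Truncated subtraction turns
  this inequality into an equation with 0, the form that minimization accepts; the search succeeds
  by \<open>k = z\<close> at the latest.\<close>

lemma prod_decode_triangle:
  defines "k \<equiv> \<lambda>z. LEAST k. Suc z - triangle (Suc k) = 0"
  shows "prod_decode z = (z - triangle (k z), k z - (z - triangle (k z)))"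
proof -
  have "\<exists>j. Suc z - triangle (Suc j) = 0"
    by (rule exI[of _ z]) simp
  then have upper: "z < triangle (Suc (k z))"
    unfolding k_def by (metis (mono_tags, lifting) LeastI_ex Suc_le_eq diff_is_0_eq)
  have lower: "triangle (k z) \<le> z"
  proof (cases "k z")
    case (Suc j)
    then have "Suc z - triangle (Suc j) \<noteq> 0"
      using not_less_Least[of j "\<lambda>k. Suc z - triangle (Suc k) = 0"] unfolding k_def by simp
    then show ?thesis using Suc by simp
  qed simp
  \<comment> \<open>The upper bound gives \<open>z - triangle (k z) \<le> k z\<close>, so no
    subtraction is truncated and the two components add up to \<open>k z\<close>.\<close>
  have "prod_encode (z - triangle (k z), k z - (z - triangle (k z))) = z"
    using lower upper by (simp add: prod_encode_def)
  then show ?thesis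
    by (metis prod_encode_inverse)
qed

lemma
  assumes f: "nary n f"
  shows nary_fst: "nary n (\<lambda>xs. fst (prod_decode (f xs)))"
    and nary_snd: "nary n (\<lambda>xs. snd (prod_decode (f xs)))"
proof -
  have ex: "\<exists>k. Suc z - triangle (Suc k) = 0" for z
    by (rule exI[of _ z]) simp
  have "nary n (\<lambda>xs. LEAST k. Suc (f xs) - triangle (Suc k) = 0)"
    by (intro nary_Least nary_diff nary_Suc nary_triangle nary_nth nary_tl f ex) simp
  note * = this nary_diff nary_triangle f
  show "nary n (\<lambda>xs. fst (prod_decode (f xs)))" "nary n (\<lambda>xs. snd (prod_decode (f xs)))"
    unfolding prod_decode_triangle fst_conv snd_conv by (intro *)+
qed

lemma nary_funpow:
  assumes "nary 1 (\<lambda>xs. h (xs ! 0))" and "nary n k" and "nary n f"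
  shows "nary n (\<lambda>xs. (h ^^ k xs) (f xs))"
proof -
  have "rec_nat a (\<lambda>i r. h r) m = (h ^^ m) a" for a m
    by (induction m) auto
  then show ?thesis
    using nary_rec[OF assms(3,2), of "\<lambda>i r xs. h r"] nary_compose1[OF assms(1) nary_nth[of 1 "Suc (Suc n)"]]
    by simp
qed


section \<open>Computable functions between encoded types\<close>

text \<open>
  Encodings are onto because minimization has to succeed on every number, hence on every code.
  Predicates are therefore treated by \<open>decidable\<close> instead of an instance for \<open>bool\<close>.
\<close>

class encodable =
  fixes enc :: "'a \<Rightarrow> nat"
  assumes bij_enc: "bij enc"
begin

definition dec :: "nat \<Rightarrow> 'a" where
  "dec = inv_into UNIV enc"

lemma enc_eq_iff [simp]: "enc x = enc y \<longleftrightarrow> x = y"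
  using bij_enc by (simp add: bij_is_inj inj_eq)

lemma enc_dec [simp]: "enc (dec k) = k"
  using bij_enc by (simp add: dec_def bij_is_surj surj_f_inv_f)

lemma dec_enc [simp]: "dec (enc x) = x"
  using bij_enc by (simp add: dec_def bij_is_inj)

end

instantiation nat :: encodable
begin
definition enc_nat :: "nat \<Rightarrow> nat" where [simp]: "enc_nat n = n"
instance by standard (simp add: bij_def inj_on_def surj_def)
end

instantiation prod :: (encodable, encodable) encodable
begin
definition enc_prod :: "'a \<times> 'b \<Rightarrow> nat" where
  "enc_prod p = prod_encode (enc (fst p), enc (snd p))"
instance
proof
  have "prod_encode (enc (fst (dec (fst (prod_decode n)) :: 'a, dec (snd (prod_decode n)) :: 'b)),
      enc (snd (dec (fst (prod_decode n)) :: 'a, dec (snd (prod_decode n)) :: 'b))) = n" for n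
    by simp
  then have "surj (enc :: 'a \<times> 'b \<Rightarrow> nat)"
    unfolding enc_prod_def surj_def by metis
  then show "bij (enc :: 'a \<times> 'b \<Rightarrow> nat)"
    by (auto simp: bij_def inj_on_def enc_prod_def)
qed
end

instantiation list :: (encodable) encodable
begin
definition enc_list :: "'a list \<Rightarrow> nat" where
  "enc_list xs = list_encode (map enc xs)"
instance
proof
  have "list_encode (map enc (map (dec :: nat \<Rightarrow> 'a) (list_decode n))) = n" for n
    by (simp add: comp_def)
  then have "surj (enc :: 'a list \<Rightarrow> nat)"
    unfolding enc_list_def surj_def by metis
  moreover have "inj (enc :: 'a \<Rightarrow> nat)"
    by (simp add: inj_on_def)
  ultimately show "bij (enc :: 'a list \<Rightarrow> nat)"
    by (auto simp: bij_def enc_list_def list_encode_eq inj_map_eq_map intro!: injI)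
qed
end

definition computable :: "('a::encodable \<Rightarrow> 'b::encodable) \<Rightarrow> bool" where
  "computable f \<longleftrightarrow> nary 1 (\<lambda>xs. enc (f (dec (xs ! 0))))"

definition decidable :: "('a::encodable \<Rightarrow> bool) \<Rightarrow> bool" where
  "decidable P \<longleftrightarrow> computable (\<lambda>x. of_bool (P x) :: nat)"

lemma computable_id: "computable (\<lambda>x. x)"
  unfolding computable_def by (simp add: nary_nth)

lemma computable_const: "computable (\<lambda>x. c)"
  unfolding computable_def by (rule nary_const)

lemma computable_compose: "computable F \<Longrightarrow> computable f \<Longrightarrow> computable (\<lambda>x. F (f x))"
  unfolding computable_def
  using nary_compose1[of "\<lambda>z. enc (F (dec z))" 1 "\<lambda>xs. enc (f (dec (xs ! 0)))"] by simp

lemma decidable_compose: "decidable P \<Longrightarrow> computable f \<Longrightarrow> decidable (\<lambda>x. P (f x))"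
  unfolding decidable_def using computable_compose[of "\<lambda>x. of_bool (P x) :: nat"] .

lemma computable_enc: "computable f \<Longrightarrow> computable (\<lambda>x. enc (f x))"
  unfolding computable_def by simp

lemma computable_dec: "computable f \<Longrightarrow> computable (\<lambda>x. dec (f x))"
  unfolding computable_def by simp

lemma computable_Pair: "computable f \<Longrightarrow> computable g \<Longrightarrow> computable (\<lambda>x. (f x, g x))"
  unfolding computable_def by (simp add: enc_prod_def nary_prod_encode)

lemma computable_fst:
  assumes "computable f"
  shows "computable (\<lambda>x. fst (f x))"
proof -
  have "enc (fst p) = fst (prod_decode (enc p))" for p :: "'b \<times> 'c"
    by (simp add: enc_prod_def)
  then show ?thesis
    using assms unfolding computable_def by (simp add: nary_fst)
qed

lemma computable_snd:
  assumes "computable f"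
  shows "computable (\<lambda>x. snd (f x))"
proof -
  have "enc (snd p) = snd (prod_decode (enc p))" for p :: "'b \<times> 'c"
    by (simp add: enc_prod_def)
  then show ?thesis
    using assms unfolding computable_def by (simp add: nary_snd)
qed

lemma computable_if:
  assumes "decidable P" and "computable f" and "computable g"
  shows "computable (\<lambda>x. if P x then f x else g x)"
proof -
  have "enc (if P x then f x else g x) = (if (of_bool (P x) :: nat) = 0 then enc (g x) else enc (f x))" for x
    by simp
  moreover have "nary 1 (\<lambda>xs. of_bool (P (dec (xs ! 0))))"
    using assms(1) unfolding decidable_def computable_def by simp
  ultimately show ?thesis
    using assms(2,3) nary_if unfolding computable_def by presburger
qed

lemma decidable_conj:
  assumes "decidable P" and "decidable Q"
  shows "decidable (\<lambda>x. P x \<and> Q x)"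
proof -
  have "computable (\<lambda>x. if P x then of_bool (Q x) else 0 :: nat)"
    using assms unfolding decidable_def[of Q] by (intro computable_if computable_const)
  moreover have "(if P x then of_bool (Q x) else 0 :: nat) = of_bool (P x \<and> Q x)" for x
    by simp
  ultimately show ?thesis
    by (simp add: decidable_def)
qed

lemma decidable_not:
  assumes "decidable P"
  shows "decidable (\<lambda>x. \<not> P x)"
proof -
  have "computable (\<lambda>x. if P x then 0 else 1 :: nat)"
    using assms by (intro computable_if computable_const)
  moreover have "(if P x then 0 else 1 :: nat) = of_bool (\<not> P x)" for x
    by simp
  ultimately show ?thesis
    by (simp add: decidable_def)
qed

lemma decidable_imp:
  assumes "decidable P" and "decidable Q"
  shows "decidable (\<lambda>x. P x \<longrightarrow> Q x)"
proof -
  have "decidable (\<lambda>x. \<not> (P x \<and> \<not> Q x))"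
    using assms by (intro decidable_not decidable_conj)
  then show ?thesis by simp
qed

lemma decidable_eq:
  assumes "computable f" and "computable g"
  shows "decidable (\<lambda>x. f x = g x)"
proof -
  \<comment> \<open>At least one of the two truncated differences is 0, and both are exactly when
    the codes agree.\<close>
  have "nary 1 (\<lambda>xs. if (enc (f (dec (xs ! 0))) - enc (g (dec (xs ! 0))))
      + (enc (g (dec (xs ! 0))) - enc (f (dec (xs ! 0)))) = 0 then 1 else 0)"
    using assms unfolding computable_def by (intro nary_if nary_add nary_diff nary_const)
  moreover have "(if (enc x - enc y) + (enc y - enc x) = 0 then 1 else 0 :: nat) = of_bool (x = y)"
    for x y :: 'b
  proof -
    have "(enc x - enc y) + (enc y - enc x) = 0 \<longleftrightarrow> enc x = enc y"
      by linarith
    then show ?thesis by (simp only: enc_eq_iff of_bool_def)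
  qed
  ultimately show ?thesis
    unfolding decidable_def computable_def by simp
qed

text \<open>A finite table is a nested case distinction, whatever \<open>f\<close> is. Data of a
  group for which no algorithm is known, such as normal forms of finitely many elements, become
  computable this way.\<close>

lemma computable_table:
  assumes "finite S"
  shows "computable (\<lambda>x. if x \<in> S then f x else d)"
  using assms
proof (induction S)
  case empty
  then show ?case using computable_const[of d] by simp
next
  case (insert a S)
  have "computable (\<lambda>x. if x = a then f a else if x \<in> S then f x else d)"
    by (intro computable_if[OF _ _ insert.IH] decidable_eq computable_id computable_const)
  moreover have "(if x = a then f a else if x \<in> S then f x else d) = (if x \<in> insert a S then f x else d)"
    for x by simp
  ultimately show ?case by simp
qed

section \<open>List operations\<close>

lemma computable_Cons:
  "computable f \<Longrightarrow> computable g \<Longrightarrow> computable (\<lambda>x. f x # g x)"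
  unfolding computable_def by (simp add: enc_list_def nary_Suc nary_prod_encode)

lemma computable_tl:
  assumes "computable f"
  shows "computable (\<lambda>x. tl (f x))"
proof -
  \<comment> \<open>The empty list has code 0, and a nonempty one has the successor of the code of
    the pair of its head and tail.\<close>
  have "enc (tl xs) = (if enc xs = 0 then 0 else snd (prod_decode (enc xs - 1)))" for xs :: "'b list"
    by (cases xs) (auto simp: enc_list_def)
  moreover have "nary 1 (\<lambda>xs. if enc (f (dec (xs ! 0))) = 0 then 0
      else snd (prod_decode (enc (f (dec (xs ! 0))) - 1)))"
    using assms unfolding computable_def by (intro nary_if nary_snd nary_diff nary_const)
  ultimately show ?thesis
    unfolding computable_def by simp
qed

lemma computable_hd:
  assumes "computable f"
  shows "computable (\<lambda>x. hd (f x))"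
proof -
  \<comment> \<open>\<open>hd []\<close> is unspecified but fixed, so its code may serve as a
    constant.\<close>
  have "enc (hd xs) = (if enc xs = 0 then enc (hd [] :: 'b) else fst (prod_decode (enc xs - 1)))"
    for xs :: "'b list"
    by (cases xs) (auto simp: enc_list_def)
  moreover have "nary 1 (\<lambda>xs. if enc (f (dec (xs ! 0))) = 0 then enc (hd [] :: 'b)
      else fst (prod_decode (enc (f (dec (xs ! 0))) - 1)))"
    using assms unfolding computable_def by (intro nary_if nary_fst nary_diff nary_const)
  ultimately show ?thesis
    unfolding computable_def by simp
qed

lemma computable_funpow:
  fixes h :: "'b::encodable \<Rightarrow> 'b"
  assumes "computable h" and "computable k" and "computable f"
  shows "computable (\<lambda>x. (h ^^ k x) (f x))"
proof -
  have "((\<lambda>z. enc (h (dec z))) ^^ m) (enc y) = enc ((h ^^ m) y)" for m y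
    by (induction m) auto
  then show ?thesis
    using nary_funpow[of "\<lambda>z. enc (h (dec z))" 1 "\<lambda>xs. k (dec (xs ! 0))"
        "\<lambda>xs. enc (f (dec (xs ! 0)))"] assms
    unfolding computable_def by simp
qed

text \<open>The code itself thus serves as a computable bound on the number of steps needed to run
  through a list.\<close>

lemma length_le_enc: "length xs \<le> enc xs"
proof (induction xs)
  case (Cons x xs)
  then show ?case
    using le_prod_encode_2[of "enc xs" "enc x"] by (simp add: enc_list_def)
qed simp

lemmas computable_intros =
  computable_id computable_const computable_enc computable_dec computable_Pair computable_fst
  computable_snd computable_if decidable_conj decidable_not decidable_imp decidable_eq
  computable_Cons computable_tl computable_hd computable_funpow

text \<open>The fold is an iteration on pairs of remaining list and accumulator. Since
  \<open>step\<close> fixes pairs with empty list, iterating too often does no harm, and the code of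
  the list is a sufficient count.\<close>

lemma computable_fold:
  assumes F: "computable (\<lambda>p. F (fst p) (snd p))" and "computable xs" and "computable b"
  shows "computable (\<lambda>x. fold F (xs x) (b x))"
proof -
  define step where "step = (\<lambda>p. if fst p = [] then p else (tl (fst p), F (hd (fst p)) (snd p)))"
  have iter: "length ys \<le> m \<Longrightarrow> (step ^^ m) (ys, y) = ([], fold F ys y)" for m ys y
  proof (induction m arbitrary: ys y)
    case (Suc m)
    then show ?case
      by (cases ys) (auto simp: step_def funpow_Suc_right simp del: funpow.simps(2))
  qed (simp add: step_def)
  have F': "computable (\<lambda>p. F (f p) (g p))" if "computable f" "computable g"
    for f :: "'z::encodable \<Rightarrow> _" and g
    using computable_compose[OF F computable_Pair[OF that]] by simp
  have "computable step"
    unfolding step_def by (intro computable_intros F')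
  then have "computable (\<lambda>x. snd ((step ^^ enc (xs x)) (xs x, b x)))"
    by (intro computable_intros assms(2,3))
  then show ?thesis
    by (simp add: iter[OF length_le_enc])
qed

lemma computable_rev: "computable f \<Longrightarrow> computable (\<lambda>x. rev (f x))"
  unfolding rev_conv_fold by (intro computable_fold computable_intros)

lemma computable_append:
  assumes "computable f" and "computable g"
  shows "computable (\<lambda>x. f x @ g x)"
proof -
  have "computable (\<lambda>x. fold (#) (rev (f x)) (g x))"
    by (intro computable_fold computable_rev computable_intros assms)
  then show ?thesis by (simp add: fold_Cons_rev)
qed

lemma computable_concat_map:
  assumes f: "computable f" and xs: "computable xs"
  shows "computable (\<lambda>x. concat (map f (xs x)))"
proof -
  have "fold (\<lambda>a acc. acc @ f a) ys acc = acc @ concat (map f ys)" for ys acc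
    by (induction ys arbitrary: acc) auto
  moreover have "computable (\<lambda>x. fold (\<lambda>a acc. acc @ f a) (xs x) [])"
    by (intro computable_fold computable_append computable_compose[OF f] computable_intros xs)
  ultimately show ?thesis by simp
qed

section \<open>Decidability for finite alphabets and unbounded search\<close>

lemma decidable_finite: "finite S \<Longrightarrow> decidable (\<lambda>x. x \<in> S)"
  using computable_table[of S "\<lambda>_. 1 :: nat" 0] unfolding decidable_def of_bool_def .

lemma decidable_lists:
  assumes "finite S"
  shows "decidable (\<lambda>xs. xs \<in> lists S)"
proof -
  \<comment> \<open>The concatenation retains precisely the letters outside
    \<open>S\<close>.\<close>
  have "concat (map (\<lambda>a. if a \<in> S then [] else [a]) xs) = [] \<longleftrightarrow> xs \<in> lists S" for xs
    by (auto split: if_splits)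
  moreover have "decidable (\<lambda>xs. concat (map (\<lambda>a. if a \<in> S then [] else [a]) xs) = [])"
    by (intro decidable_finite[OF assms] computable_concat_map computable_intros)
  ultimately show ?thesis by simp
qed

lemma computable_Least:
  fixes P :: "'a::encodable \<Rightarrow> nat \<Rightarrow> bool"
  assumes P: "decidable (\<lambda>p. P (fst p) (snd p))" and ex: "\<And>x. \<exists>k. P x k"
  shows "computable (\<lambda>x. LEAST k. P x k)"
proof -
  let ?Q = "\<lambda>p. of_bool (\<not> P (fst p) (snd p)) :: nat"
  have "nary 1 (\<lambda>xs. ?Q (dec (xs ! 0)))"
    using decidable_not[OF P] unfolding decidable_def computable_def by simp
  \<comment> \<open>Minimization varies the first argument, whereas \<open>P\<close> takes its
    candidate second; hence the swap.\<close>
  moreover have "nary (Suc 1) (\<lambda>xs. prod_encode (tl xs ! 0, xs ! 0))"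
    by (intro nary_prod_encode nary_nth nary_tl) simp_all
  ultimately have "nary (Suc 1) (\<lambda>xs. ?Q (dec (prod_encode (tl xs ! 0, xs ! 0))))"
    by (rule nary_compose1[of "\<lambda>z. ?Q (dec z)"])
  moreover have "dec (prod_encode (z, k)) = (dec z :: 'a, k)" for z k
    using dec_enc[of "(dec z :: 'a, k)"] by (simp add: enc_prod_def)
  ultimately have "nary (Suc 1) (\<lambda>xs. of_bool (\<not> P (dec (tl xs ! 0)) (xs ! 0)))"
    by simp
  then have "nary 1 (\<lambda>xs. LEAST k. of_bool (\<not> P (dec (xs ! 0)) k) = (0 :: nat))"
    using ex by (intro nary_Least) auto
  then show ?thesis
    by (simp add: computable_def)
qed

text \<open>All codes of possible \<open>y\<close> are searched. Minimization demands that the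
  search succeed everywhere, so the condition is made vacuous outside \<open>D\<close>. Applied to a
  decidable graph, this yields an algorithm for the function itself.\<close>

lemma computable_choice:
  assumes D: "decidable (\<lambda>x. x \<in> D)" and R: "decidable (\<lambda>p. R (fst p) (snd p))"
    and ex: "\<And>x. x \<in> D \<Longrightarrow> \<exists>y. R x y"
  obtains f where "computable f" and "\<And>x. x \<in> D \<Longrightarrow> R x (f x)"
proof
  let ?k = "\<lambda>x. LEAST k. x \<in> D \<longrightarrow> R x (dec k)"
  have ex': "\<exists>k. x \<in> D \<longrightarrow> R x (dec k)" for x
    using ex by (metis dec_enc)
  have "decidable (\<lambda>p. R (fst p) (dec (snd p)))"
    using decidable_compose[OF R computable_Pair[OF computable_fst computable_dec[OF computable_snd]],
        OF computable_id computable_id] by simp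
  then have "computable ?k"
    by (intro computable_Least ex' computable_intros decidable_compose[OF D])
  then show "computable (\<lambda>x. dec (?k x))"
    by (rule computable_dec)
  show "R x (dec (?k x))" if "x \<in> D" for x
    using LeastI_ex[OF ex', of x] that by blast
qed

text \<open>Since \<open>enc\<close> is onto, every number is the code of some \<open>x\<close>, and
  no invalid codes have to be excluded.\<close>

lemma recursive_set_image_enc:
  "recursive_set (enc ` S) \<longleftrightarrow> decidable (\<lambda>x. x \<in> S)"
proof -
  have mem: "x \<in> enc ` S \<longleftrightarrow> dec x \<in> S" for x
    by (metis enc_dec image_iff dec_enc)
  have len: "(\<forall>xs. length xs = 1 \<longrightarrow> F xs = h (xs ! 0)) \<longleftrightarrow> (\<forall>x. F [x] = h x)"
    for F and h :: "nat \<Rightarrow> nat"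
    by (auto simp: length_Suc_conv)
  show ?thesis
    unfolding recursive_set_def decidable_def computable_def nary_def mem of_bool_def enc_nat_def
    by (subst len) simp
qed


section \<open>The reduction machine of a stacking\<close>

text \<open>
  The state consists of a stack (a word stored in reverse) and the word still to be read.
  The parameters play the role of the map \<open>(w, a) \<mapsto> c'(e\<^bsub>w,a\<^esub>)\<close> and of the formal inverse.
\<close>

definition reduce ::
  "('l list \<times> 'l \<Rightarrow> 'l list) \<Rightarrow> ('l \<Rightarrow> 'l) \<Rightarrow> 'l list \<times> 'l list \<Rightarrow> 'l list \<times> 'l list" where
  "reduce \<phi> \<iota> p =
     (if snd p = [] then p
      else if \<phi> (rev (fst p), hd (snd p)) = [hd (snd p)]
      then if fst p \<noteq> [] \<and> hd (fst p) = \<iota> (hd (snd p)) then (tl (fst p), tl (snd p))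
           else (hd (snd p) # fst p, tl (snd p))
      else (fst p, \<phi> (rev (fst p), hd (snd p)) @ tl (snd p)))"

lemma computable_reduce:
  assumes "computable \<phi>" and "computable \<iota>"
  shows "computable (reduce \<phi> \<iota>)"
proof -
  have "computable (\<lambda>p. reduce \<phi> \<iota> p)"
    unfolding reduce_def
    by (intro computable_intros computable_append computable_rev
        computable_compose[OF assms(1)] computable_compose[OF assms(2)])
  then show ?thesis by simp
qed

section \<open>Correctness of the machine\<close>

context symmetric_generating_set
begin

lemma word_val_closed: "w \<in> lists A \<Longrightarrow> word_val w \<in> carrier G"
  by (induction w) (auto simp: rep_closed)

lemma word_val_append:
  "u \<in> lists A \<Longrightarrow> v \<in> lists A \<Longrightarrow> word_val (u @ v) = word_val u \<otimes> word_val v"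
  by (induction u) (auto simp: rep_closed word_val_closed m_assoc)

lemma nf_word_val:
  assumes "normal_forms N" and "g \<in> carrier G"
  shows "nf N g \<in> lists A" and "word_val (nf N g) = g"
proof -
  have "\<exists>!w. w \<in> N \<and> word_val w = g" and "N \<subseteq> lists A"
    using assms unfolding normal_forms_def by blast+
  moreover from this(1) have "nf N g \<in> N \<and> word_val (nf N g) = g"
    unfolding nf_def by (rule theI')
  ultimately show "nf N g \<in> lists A" "word_val (nf N g) = g"
    by blast+
qed

lemma path_edges_subset:
  "g \<in> carrier G \<Longrightarrow> w \<in> lists A \<Longrightarrow> path_edges g w \<subseteq> edges"
  by (induction w arbitrary: g) (auto simp: edges_def rep_closed)

text \<open>The number of recursive edges below an edge is a measure: it is finite by assumption,
  and it drops along the order because by transitivity everything below \<open>e'\<close> is below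
  \<open>e\<close>, while \<open>e'\<close> is below \<open>e\<close> but not below itself.\<close>

lemma wf_edge_order:
  assumes "stacking N c"
  shows "wf (edge_order N c)"
proof -
  let ?below = "\<lambda>e. {e' \<in> recursive_edges N. (e', e) \<in> edge_order N c}"
  have sub: "edge_order N c \<subseteq> recursive_edges N \<times> recursive_edges N"
    unfolding edge_order_def by (rule trancl_subset_Sigma) auto
  have "card (?below e') < card (?below e)" if "(e', e) \<in> edge_order N c" for e' e
  proof (rule psubset_card_mono)
    show "finite (?below e)"
      using assms that sub unfolding stacking_def by blast
    have "trans (edge_order N c)" "(e', e') \<notin> edge_order N c"
      using assms unfolding stacking_def irrefl_def by blast+
    then show "?below e' \<subset> ?below e"
      using that sub by (auto dest: transD)
  qed
  then have "edge_order N c \<subseteq> measure (\<lambda>e. card (?below e))"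
    by auto
  then show ?thesis
    using wf_measure wf_subset by blast
qed

text \<open>
  Normal forms are not assumed to be prefix-closed; demanding it of the word on the stack is what
  makes the choice between pushing and popping along a degenerate edge unambiguous.
\<close>

definition stack_at :: "'l list set \<Rightarrow> 'a \<Rightarrow> 'l list \<Rightarrow> bool" where
  "stack_at N g s \<longleftrightarrow> rev s \<in> lists A \<and> word_val (rev s) = g \<and>
     (\<forall>n. nf N (word_val (take n (rev s))) = take n (rev s))"

lemma stack_at_nf: "stack_at N g s \<Longrightarrow> nf N g = rev s"
  unfolding stack_at_def by (metis order_refl take_all)

lemma stack_at_push:
  assumes "stack_at N g s" and "a \<in> A" and "nf N (g \<otimes> rep a) = rev s @ [a]"
  shows "stack_at N (g \<otimes> rep a) (a # s)"
proof -
  have val: "word_val (rev s @ [a]) = g \<otimes> rep a"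
    using assms(1,2) unfolding stack_at_def by (subst word_val_append) (auto simp: rep_closed)
  have "nf N (word_val (take n (rev s @ [a]))) = take n (rev s @ [a])" for n
  proof (cases "n \<le> length s")
    case True
    then show ?thesis using assms(1) by (simp add: stack_at_def)
  next
    case False
    then have "take n (rev s @ [a]) = rev s @ [a]" by simp
    then show ?thesis using val assms(3) by (simp only:)
  qed
  then show ?thesis
    using assms val by (simp add: stack_at_def)
qed

text \<open>The shortened stack is a prefix of the old one, and all prefixes of a stack are normal
  forms. Hence nothing about the normal form at the new vertex has to be assumed.\<close>

lemma stack_at_pop:
  assumes "stack_at N g (formal_inv a # s)" and "a \<in> A"
  shows "stack_at N (g \<otimes> rep a) s"
proof -
  have s: "rev s \<in> lists A"
    using assms by (auto simp: stack_at_def)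
  then have "word_val (rev s @ [formal_inv a]) = word_val (rev s) \<otimes> inv (rep a)"
    using assms(2) by (subst word_val_append) (auto simp: formal_inv_closed rep_formal_inv rep_closed)
  then have g: "g = word_val (rev s) \<otimes> inv (rep a)"
    using assms(1) by (simp add: stack_at_def)
  have "word_val (rev s) = g \<otimes> rep a"
    unfolding g using word_val_closed[OF s] rep_closed[OF assms(2)] by (simp add: m_assoc)
  moreover have "nf N (word_val (take n (rev s))) = take n (rev s)" for n
  proof -
    \<comment> \<open>For \<open>n > length s\<close> the old stack would contribute its last letter
      as well, so the cut is made no later than at \<open>length s\<close>.\<close>
    have "take (min n (length s)) (rev (formal_inv a # s)) = take n (rev s)"
      by (simp add: min_def)
    then show ?thesis
      using assms(1) unfolding stack_at_def by metis
  qed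
  ultimately show ?thesis
    using s by (simp add: stack_at_def)
qed

text \<open>\<open>\<phi>\<close> and \<open>\<iota>\<close> are constrained only on words and
  letters over \<open>A\<close>, because the computable functions substituted later are controlled
  only there. The proof nests an induction along words inside a well-founded induction on
  edges.\<close>

lemma reduce_word:
  assumes stk: "stacking N c"
    and \<phi>: "\<And>w a. w \<in> lists A \<Longrightarrow> a \<in> A \<Longrightarrow> \<phi> (w, a) = extended_map N c (word_val w, a)"
    and \<iota>: "\<And>a. a \<in> A \<Longrightarrow> \<iota> a = formal_inv a"
    and w: "w \<in> lists A"
  shows "\<exists>k t. (reduce \<phi> \<iota> ^^ k) ([], w) = (t, []) \<and> (t = [] \<longleftrightarrow> word_val w = \<one>)"
proof -
  \<comment> \<open>Allowing every admissible stack and every remaining input \<open>v\<close>,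
    which is left untouched, makes crossings of successive edges composable.\<close>
  define crosses where "crosses = (\<lambda>(g, a). \<forall>s v. stack_at N g s \<longrightarrow>
    (\<exists>k t. (reduce \<phi> \<iota> ^^ k) (s, a # v) = (t, v) \<and> stack_at N (g \<otimes> rep a) t))"
  have path: "\<exists>k t. (reduce \<phi> \<iota> ^^ k) (s, u @ v) = (t, v) \<and> stack_at N (g \<otimes> word_val u) t"
    if "g \<in> carrier G" "u \<in> lists A" "stack_at N g s" "\<And>e. e \<in> path_edges g u \<Longrightarrow> crosses e" for g u s v
    using that
  proof (induction u arbitrary: g s)
    case Nil
    then have "(reduce \<phi> \<iota> ^^ 0) (s, [] @ v) = (s, v) \<and> stack_at N (g \<otimes> word_val []) s"
      by simp
    then show ?case by blast
  next
    case (Cons a u)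
    have a: "a \<in> A" and u: "u \<in> lists A" using Cons.prems by auto
    have "crosses (g, a)" using Cons.prems by simp
    then obtain k t where k: "(reduce \<phi> \<iota> ^^ k) (s, a # u @ v) = (t, u @ v)" "stack_at N (g \<otimes> rep a) t"
      unfolding crosses_def using Cons.prems(3) by blast
    obtain l t' where l: "(reduce \<phi> \<iota> ^^ l) (t, u @ v) = (t', v)"
      "stack_at N (g \<otimes> rep a \<otimes> word_val u) t'"
      using Cons.IH[OF _ u k(2)] Cons.prems a by (auto simp: rep_closed)
    have "(reduce \<phi> \<iota> ^^ (l + k)) (s, (a # u) @ v) = (t', v)"
      using k l by (simp add: funpow_add)
    moreover have "g \<otimes> rep a \<otimes> word_val u = g \<otimes> word_val (a # u)"
      using Cons.prems(1) a u by (simp add: m_assoc rep_closed word_val_closed)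
    ultimately show ?case using l(2) by metis
  qed
  have degenerate: "crosses e" if "e \<in> edges" "e \<notin> recursive_edges N" for e
  proof -
    obtain g a where e: "e = (g, a)" by fastforce
    have a: "a \<in> A" and deg: "nf N g @ [a] = nf N (g \<otimes> rep a) \<or>
        nf N g = nf N (g \<otimes> rep a) @ [formal_inv a]"
      using that by (auto simp: e edges_def recursive_edges_def degenerate_edges_def)
    have "\<exists>t. reduce \<phi> \<iota> (s, a # v) = (t, v) \<and> stack_at N (g \<otimes> rep a) t" if s: "stack_at N g s" for s v
    proof -
      have "\<phi> (rev s, a) = [a]"
        using s a \<phi>[of "rev s" a] \<open>e \<notin> recursive_edges N\<close>
        by (simp add: stack_at_def extended_map_def e)
      \<comment> \<open>With \<open>formal_inv a\<close> on top, popping is right whichever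
        alternative of degeneracy is given, since the prefixes of the stack are normal
        forms.\<close>
      moreover have "stack_at N (g \<otimes> rep a) (tl s)" if "s \<noteq> []" "hd s = \<iota> a"
        using stack_at_pop[of N g a "tl s"] that s a \<iota> by (cases s) auto
      moreover have "stack_at N (g \<otimes> rep a) (a # s)" if "\<not> (s \<noteq> [] \<and> hd s = \<iota> a)"
      proof -
        \<comment> \<open>The alternative of degeneracy that would put \<open>formal_inv a\<close>
          on top of the stack is excluded; the other one is what a push requires.\<close>
        have "rev s \<noteq> nf N (g \<otimes> rep a) @ [formal_inv a]"
          using that \<iota>[OF a] by (cases s) auto
        then show ?thesis
          using deg stack_at_nf[OF s] stack_at_push[OF s a] by simp
      qed
      ultimately show ?thesis
        by (simp add: reduce_def)
    qed
    then have "\<exists>k t. (reduce \<phi> \<iota> ^^ k) (s, a # v) = (t, v) \<and> stack_at N (g \<otimes> rep a) t"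
      if "stack_at N g s" for s v
      using that by (auto intro: exI[of _ 1])
    then show ?thesis by (simp add: crosses_def e)
  qed
  have edge: "e \<in> edges \<Longrightarrow> crosses e" for e
  proof (induction e rule: wf_induct_rule[OF wf_edge_order[OF stk]])
    case (1 e)
    show ?case
    proof (cases "e \<in> recursive_edges N")
      case rec: True
      obtain g a where e: "e = (g, a)" by fastforce
      have g: "g \<in> carrier G" and a: "a \<in> A"
        using 1 by (auto simp: e edges_def)
      have c: "c e \<in> lists A" "word_val (c e) = rep a"
        using stk rec unfolding stacking_def e by blast+
      have below: "e' \<in> recursive_edges N \<Longrightarrow> e' \<in> path_edges g (c e) \<Longrightarrow> (e', e) \<in> edge_order N c" for e'
        unfolding edge_order_def using rec by (intro r_into_trancl) (simp add: e)
      \<comment> \<open>Otherwise \<open>e\<close> would lie on its own path and so below itself.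
        Hence the test against \<open>[a]\<close> in \<open>reduce\<close> tells recursive edges
        from degenerate ones.\<close>
      have "c e \<noteq> [a]"
        using below[OF rec] stk unfolding stacking_def irrefl_def by (auto simp: e)
      \<comment> \<open>Recursive edges on the path are smaller and fall under the induction
        hypothesis; degenerate ones need no induction.\<close>
      have crosses: "crosses e'" if "e' \<in> path_edges g (c e)" for e'
        using that 1(1) below degenerate path_edges_subset[OF g c(1)] by blast
      have "\<exists>k t. (reduce \<phi> \<iota> ^^ k) (s, a # v) = (t, v) \<and> stack_at N (g \<otimes> rep a) t"
        if s: "stack_at N g s" for s v
      proof -
        have "\<phi> (rev s, a) = c e"
          using s a rec \<phi>[of "rev s" a] by (simp add: stack_at_def extended_map_def e)
        then have "reduce \<phi> \<iota> (s, a # v) = (s, c e @ v)"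
          using \<open>c e \<noteq> [a]\<close> by (simp add: reduce_def)
        moreover obtain k t where "(reduce \<phi> \<iota> ^^ k) (s, c e @ v) = (t, v)" "stack_at N (g \<otimes> rep a) t"
          using path[OF g c(1) s crosses, of v] c(2) by metis
        ultimately have "(reduce \<phi> \<iota> ^^ Suc k) (s, a # v) = (t, v) \<and> stack_at N (g \<otimes> rep a) t"
          by (simp add: funpow_swap1)
        then show ?thesis by blast
      qed
      then show ?thesis by (simp add: crosses_def e)
    qed (use 1 degenerate in blast)
  qed
  \<comment> \<open>The empty normal form of the identity makes the empty stack an admissible start,
    and makes an empty final stack equivalent to value \<open>\<one>\<close>.\<close>
  have one: "nf N \<one> = []"
    using stk unfolding stacking_def by blast
  then have "stack_at N \<one> []"
    by (simp add: stack_at_def)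
  then obtain k t where t: "(reduce \<phi> \<iota> ^^ k) ([], w @ []) = (t, [])" "stack_at N (\<one> \<otimes> word_val w) t"
    using path[OF one_closed w] edge path_edges_subset[OF one_closed w] by blast
  have "stack_at N (word_val w) t"
    using t(2) word_val_closed[OF w] by simp
  then have "t = [] \<longleftrightarrow> word_val w = \<one>"
    using one stack_at_nf[of N "word_val w" t] by (auto simp: stack_at_def)
  then show ?thesis
    using t(1) by auto
qed

end


section \<open>The word problem\<close>

lemma list_encode_eq_enc: "list_encode = enc"
  unfolding enc_list_def by (rule ext) (metis enc_nat_def map_idI)

lemma triple_encode_eq_enc: "triple_encode = enc"
  by (rule ext) (auto simp: triple_encode_def enc_prod_def list_encode_eq_enc)

text \<open>The least halting time is found by minimization. Halted states are fixed, so the state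
  at that time agrees with the one reached at any later time, and \<open>r\<close> may be given by
  mere existence.\<close>

lemma computable_halting_state:
  fixes h :: "'a::encodable \<times> 'b::encodable list \<Rightarrow> 'a \<times> 'b list"
  assumes h: "computable h" and f: "computable f"
    and halted: "\<And>p. snd p = [] \<Longrightarrow> h p = p"
    and halts: "\<And>x. \<exists>k. (h ^^ k) (f x) = (r x, [])"
  shows "computable r"
proof -
  let ?halted = "\<lambda>x k. snd ((h ^^ k) (f x)) = []"
  have ex: "\<exists>k. ?halted x k" for x
    using halts[of x] by (metis snd_conv)
  have stays: "(h ^^ m) p = p" if "snd p = []" for m p
    using halted[OF that] by (induction m) auto
  have "fst ((h ^^ (LEAST k. ?halted x k)) (f x)) = r x" for x
  proof -
    obtain k where k: "(h ^^ k) (f x) = (r x, [])"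
      using halts by blast
    then have "(LEAST k. ?halted x k) \<le> k"
      by (intro Least_le) simp
    then obtain m where "k = m + (LEAST k. ?halted x k)"
      by (metis le_add_diff_inverse2)
    then have "(h ^^ k) (f x) = (h ^^ (LEAST k. ?halted x k)) (f x)"
      using stays[OF LeastI_ex[OF ex]] by (simp add: funpow_add)
    then show ?thesis using k by (metis fst_conv)
  qed
  moreover have "computable (\<lambda>x. fst ((h ^^ (LEAST k. ?halted x k)) (f x)))"
    by (intro computable_intros computable_Least ex h f computable_compose[OF f])
  ultimately show ?thesis by simp
qed

text \<open>The alphabet \<open>B\<close> of the input is unrelated to the alphabet \<open>A\<close>
  carrying the stacking; a letterwise translation that preserves values connects them.\<close>

lemma word_problem_decidable:
  fixes A B :: "nat set"
  assumes A: "symmetric_generating_set G A rep finv"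
    and stk: "symmetric_generating_set.stacking G A rep finv N c"
    and rec: "recursive_set (triple_encode ` symmetric_generating_set.stacking_set G A rep finv N c)"
    and B: "symmetric_generating_set G B rep' finv'"
  shows "recursive_set (list_encode ` symmetric_generating_set.word_problem G B rep')"
proof -
  interpret A: symmetric_generating_set G A rep finv by (rule A)
  interpret B: symmetric_generating_set G B rep' finv' by (rule B)
  let ?S = "A.stacking_set N c"
  let ?D = "lists A \<times> A"
  have "decidable (\<lambda>p. fst p \<in> lists A \<and> snd p \<in> A)"
    by (intro computable_intros decidable_compose[OF decidable_lists[OF A.finite_letters]]
        decidable_compose[OF decidable_finite[OF A.finite_letters]])
  then have D: "decidable (\<lambda>p. p \<in> ?D)"
    by (simp add: mem_Times_iff)
  have "decidable (\<lambda>t. t \<in> ?S)"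
    using rec by (simp add: triple_encode_eq_enc recursive_set_image_enc)
  then have R: "decidable (\<lambda>q. (fst (fst q), snd (fst q), snd q) \<in> ?S)"
    by (rule decidable_compose) (intro computable_intros)
  have S: "(w, a, u) \<in> ?S \<longleftrightarrow> w \<in> lists A \<and> a \<in> A \<and> u = A.extended_map N c (A.word_val w, a)" for w a u
    unfolding A.stacking_set_def by auto
  \<comment> \<open>On \<open>?D\<close> the set \<open>?S\<close> is the graph of the extended map,
    so searching for the third component computes that map.\<close>
  obtain \<phi> where \<phi>: "computable \<phi>" "\<And>p. p \<in> ?D \<Longrightarrow> (fst p, snd p, \<phi> p) \<in> ?S"
    by (rule computable_choice[OF D R]) (auto simp: S)
  define \<iota> where "\<iota> = (\<lambda>a. if a \<in> A then finv a else 0)"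
  have \<iota>: "computable \<iota>"
    unfolding \<iota>_def by (rule computable_table[OF A.finite_letters])
  \<comment> \<open>The default \<open>[]\<close> makes every list of numbers translate into a word
    over \<open>A\<close>. The machine then halts on every input, as minimization requires, and not
    only on words over \<open>B\<close>.\<close>
  define \<tau> where "\<tau> = (\<lambda>b. if b \<in> B then A.nf N (rep' b) else [])"
  have \<tau>: "computable \<tau>"
    unfolding \<tau>_def by (rule computable_table[OF B.finite_letters])
  have nf: "A.normal_forms N"
    using stk unfolding A.stacking_def by blast
  have \<tau>_lists: "concat (map \<tau> w) \<in> lists A" for w
    using A.nf_word_val(1)[OF nf B.rep_closed] by (induction w) (auto simp: \<tau>_def)
  have \<tau>_val: "A.word_val (concat (map \<tau> w)) = B.word_val w" if "w \<in> lists B" for w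
    using that
  proof (induction w)
    case (Cons b w)
    have "\<tau> b \<in> lists A" "A.word_val (\<tau> b) = rep' b"
      using Cons.hyps(1) A.nf_word_val[OF nf B.rep_closed] by (auto simp: \<tau>_def)
    then show ?case
      using Cons.IH \<tau>_lists by (simp add: A.word_val_append)
  qed simp
  have "\<exists>k t. (reduce \<phi> \<iota> ^^ k) ([], concat (map \<tau> w)) = (t, []) \<and>
      (t = [] \<longleftrightarrow> A.word_val (concat (map \<tau> w)) = \<one>\<^bsub>G\<^esub>)" for w
    using \<phi>(2) by (intro A.reduce_word[OF stk _ _ \<tau>_lists]) (auto simp: S \<iota>_def)
  then obtain r where r: "\<And>w. \<exists>k. (reduce \<phi> \<iota> ^^ k) ([], concat (map \<tau> w)) = (r w, [])"
    "\<And>w. r w = [] \<longleftrightarrow> A.word_val (concat (map \<tau> w)) = \<one>\<^bsub>G\<^esub>"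
    by metis
  have "computable (\<lambda>w. ([], concat (map \<tau> w)))"
    by (intro computable_intros computable_concat_map \<tau>)
  then have "computable r"
    by (rule computable_halting_state[OF computable_reduce[OF \<phi>(1) \<iota>] _ _ r(1)]) (simp add: reduce_def)
  \<comment> \<open>Inputs with letters outside \<open>B\<close>, which \<open>\<tau>\<close>
    erases, are rejected here by the test for \<open>lists B\<close>.\<close>
  then have "decidable (\<lambda>w. w \<in> lists B \<and> r w = [])"
    by (intro computable_intros decidable_lists B.finite_letters)
  moreover have "w \<in> lists B \<and> r w = [] \<longleftrightarrow> w \<in> B.word_problem" for w
    unfolding B.word_problem_def mem_Collect_eq r(2) by (rule conj_cong[OF refl]) (simp only: \<tau>_val)
  ultimately show ?thesis
    by (simp add: list_encode_eq_enc recursive_set_image_enc)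
qed

theorem proposition1p7:
  fixes G :: "('a, 'b) monoid_scheme"
  assumes "group G" and "algorithmically_stackable G"
  shows "solvable_word_problem G"
proof -
  obtain A :: "nat set" and rep formal_inv N c where
    "symmetric_generating_set G A rep formal_inv"
    "symmetric_generating_set.stacking G A rep formal_inv N c"
    "recursive_set (triple_encode ` symmetric_generating_set.stacking_set G A rep formal_inv N c)"
    using assms(2) unfolding algorithmically_stackable_def by metis
  note word_problem_decidable[OF this] this(1)
  then show ?thesis
    unfolding solvable_word_problem_def by metis
qed

end
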